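(* $\mathcal{S}=\bigoplus_{k\ge 0}\mathbb{C}t_k$ is an irreducible highest weight module for the Lie algebra $\mathcal{L}_L$, with highest weight vector $w_\alpha=t_0$.
   Context: $\mathcal{L}_L$ is the complex Lie algebra with basis $\{Z_{n,m}: n,m\in\mathbb{Z},\ n,m\ge 0\}$ and bracket $$[Z_{n,m},Z_{l,s}]=\Theta(l-m)Z_{l-m+n,\,s}-\Theta(s-n)Z_{l,\,s-n+m}-\Theta(n-s)Z_{n-s+l,\,m}+\Theta(m-l)Z_{n,\,m-l+s}-\delta_{m,l}Z_{n,s}+\delta_{n,s}Z_{l,m},$$ where $\Theta(x)=1$ if $x\ge 0$ and $\Theta(x)=0$ if $x<0$, $\delta$ is the Kronecker delta, and terms with vanishing coefficient are read as $0$. It is $\mathbb{Z}$-graded by $l_n=\mathrm{span}_{\mathbb{C}}\{Z_{k,m}:k-m=n\}$. The action on $\mathcal{S}$ is $Z_{n,m}t_k=0$ if $m>k$ and $Z_{n,m}t_k=t_{k-m+n}$ if $m\le k$; $t_k$ has degree $k$. For a $\mathbb{Z}$-graded Lie algebra $\mathfrak g=\bigoplus_n\mathfrak g_n$, put $\mathfrak g_+=\bigoplus_{n>0}\mathfrak g_n$ and $\mathfrak g_-=\bigoplus_{n<0}\mathfrak g_n$. A highest weight $\mathfrak g$-module of highest weight $\alpha\in\mathfrak g_0^*$ is a $\mathbb{Z}$-graded $\mathfrak g$-module $V(\alpha)=\bigoplus_{n\ge 0}V_n$ such that: (a) $V_0=\mathbb{C}w_\alpha$ with $w_\alpha\ne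 0$; (b) $hw_\alpha=\alpha(h)w_\alpha$ for all $h\in\mathfrak g_0$; (c) $\mathfrak g_-w_\alpha=0$; (d) $\mathcal{U}(\mathfrak g_+)w_\alpha=V(\alpha)$, where $\mathcal{U}$ denotes the universal enveloping algebra. The vector $w_\alpha$ is called the highest weight vector. *)

theory Defs
  imports Complex_Main "HOL-Library.Poly_Mapping" "HOL-Algebra.QuotRing"
begin

section \<open>The free associative algebra on a set\<close>

text \<open>
  Lists with concatenation are wrapped in a type of their own, so that the library's
  convolution product on finitely supported functions makes
  \<^typ>\<open>'a list\<close>-indexed combinations the free associative algebra.
\<close>

datatype 'a word = Word (letters: "'a list")

instantiation word :: (type) monoid_add
begin

definition zero_word :: "'a word" where
  "zero_word = Word []"

definition plus_word :: "'a word \<Rightarrow> 'a word \<Rightarrow> 'a word" where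
  "plus_word u v = Word (letters u @ letters v)"

instance
  by standard (simp_all add: zero_word_def plus_word_def)

end

definition pscale :: "complex \<Rightarrow> ('a \<Rightarrow>\<^sub>0 complex) \<Rightarrow> ('a \<Rightarrow>\<^sub>0 complex)" where
  "pscale c p = Poly_Mapping.map ((*) c) p"

type_synonym 'a free_alg = "'a word \<Rightarrow>\<^sub>0 complex"

definition gen :: "'a \<Rightarrow> 'a free_alg" where
  "gen x = Poly_Mapping.single (Word [x]) 1"

definition free_ring :: "'a set \<Rightarrow> 'a free_alg ring" where
  "free_ring P =
    \<lparr>carrier = {f. \<forall>u \<in> Poly_Mapping.keys f. set (letters u) \<subseteq> P},
     mult = (*), one = 1, zero = 0, add = (+)\<rparr>"

section \<open>Graded Lie algebras\<close>

definition internal_direct_sum :: "(int \<Rightarrow> 'v::ab_group_add set) \<Rightarrow> bool" where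
  "internal_direct_sum A \<longleftrightarrow>
    (\<forall>x. \<exists>!f. (\<forall>n. f n \<in> A n) \<and> finite {n. f n \<noteq> 0} \<and> x = (\<Sum>n \<in> {n. f n \<noteq> 0}. f n))"

locale lie_algebra = vector_space scale
  for scale :: "complex \<Rightarrow> 'g::ab_group_add \<Rightarrow> 'g" +
  fixes bracket :: "'g \<Rightarrow> 'g \<Rightarrow> 'g"
  assumes bracket_linear_right: "Vector_Spaces.linear scale scale (\<lambda>y. bracket x y)"
    and bracket_linear_left: "Vector_Spaces.linear scale scale (\<lambda>x. bracket x y)"
    and bracket_self: "bracket x x = 0"
    and jacobi: "bracket x (bracket y z) + bracket y (bracket z x) + bracket z (bracket x y) = 0"
begin

text \<open>
  For a Lie subalgebra \<open>P\<close>, the universal enveloping algebra \<open>U(P)\<close> is the free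
  associative algebra on the underlying set of \<open>P\<close> modulo the two-sided ideal that makes the
  canonical map \<open>P \<rightarrow> U(P)\<close> linear and turns brackets into commutators. This is the tensor
  algebra of \<open>P\<close> modulo \<open>x \<otimes> y - y \<otimes> x - [x, y]\<close>, with the linear relations of the tensor
  algebra imposed in the same step.
\<close>

definition env_relations :: "'g set \<Rightarrow> 'g free_alg set" where
  "env_relations P =
     {gen (x + y) - gen x - gen y | x y. x \<in> P \<and> y \<in> P} \<union>
     {gen (scale c x) - pscale c (gen x) | c x. x \<in> P} \<union>
     {gen x * gen y - gen y * gen x - gen (bracket x y) | x y. x \<in> P \<and> y \<in> P}"

definition env_algebra :: "'g set \<Rightarrow> 'g free_alg set ring" where
  "env_algebra P = free_ring P Quot (Idl\<^bsub>free_ring P\<^esub> (env_relations P))"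

end

locale graded_lie_algebra = lie_algebra scale bracket
  for scale :: "complex \<Rightarrow> 'g::ab_group_add \<Rightarrow> 'g"
    and bracket :: "'g \<Rightarrow> 'g \<Rightarrow> 'g" +
  fixes G :: "int \<Rightarrow> 'g set"
  assumes subspace_G: "subspace (G n)"
    and direct_sum_G: "internal_direct_sum G"
    and bracket_G: "x \<in> G m \<Longrightarrow> y \<in> G n \<Longrightarrow> bracket x y \<in> G (m + n)"
begin

definition pos_part :: "'g set" where
  "pos_part = span (\<Union>n\<in>{0<..}. G n)"

definition neg_part :: "'g set" where
  "neg_part = span (\<Union>n\<in>{..<0}. G n)"

end

section \<open>Modules\<close>

locale lie_module = lie_algebra scale bracket + V: vector_space scaleV
  for scale :: "complex \<Rightarrow> 'g::ab_group_add \<Rightarrow> 'g"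
    and bracket :: "'g \<Rightarrow> 'g \<Rightarrow> 'g"
    and scaleV :: "complex \<Rightarrow> 'v::ab_group_add \<Rightarrow> 'v" +
  fixes act :: "'g \<Rightarrow> 'v \<Rightarrow> 'v"
  assumes act_linear_right: "Vector_Spaces.linear scaleV scaleV (\<lambda>v. act x v)"
    and act_linear_left: "Vector_Spaces.linear scale scaleV (\<lambda>x. act x v)"
    and act_bracket: "act (bracket x y) v = act x (act y v) - act y (act x v)"
begin

definition free_act :: "'g free_alg \<Rightarrow> 'v \<Rightarrow> 'v" where
  "free_act f v =
    (\<Sum>u \<in> Poly_Mapping.keys f. scaleV (Poly_Mapping.lookup f u) (foldr act (letters u) v))"

text \<open>
  An element of the enveloping algebra is a coset, all of whose representatives act in the same
  way; the image below is therefore a singleton.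
\<close>

definition env_act :: "'g free_alg set \<Rightarrow> 'v \<Rightarrow> 'v" where
  "env_act C v = the_elem ((\<lambda>f. free_act f v) ` C)"

definition submodule :: "'v set \<Rightarrow> bool" where
  "submodule W \<longleftrightarrow> V.subspace W \<and> (\<forall>x. \<forall>v\<in>W. act x v \<in> W)"

end

locale irreducible_lie_module = lie_module scale bracket scaleV act
  for scale :: "complex \<Rightarrow> 'g::ab_group_add \<Rightarrow> 'g"
    and bracket :: "'g \<Rightarrow> 'g \<Rightarrow> 'g"
    and scaleV :: "complex \<Rightarrow> 'v::ab_group_add \<Rightarrow> 'v"
    and act :: "'g \<Rightarrow> 'v \<Rightarrow> 'v" +
  assumes nontrivial: "\<exists>v::'v. v \<noteq> 0"
    and irreducible: "submodule W \<Longrightarrow> W = {0} \<or> W = UNIV"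

locale graded_lie_module =
  graded_lie_algebra scale bracket G + lie_module scale bracket scaleV act
  for scale :: "complex \<Rightarrow> 'g::ab_group_add \<Rightarrow> 'g"
    and bracket :: "'g \<Rightarrow> 'g \<Rightarrow> 'g"
    and G :: "int \<Rightarrow> 'g set"
    and scaleV :: "complex \<Rightarrow> 'v::ab_group_add \<Rightarrow> 'v"
    and act :: "'g \<Rightarrow> 'v \<Rightarrow> 'v" +
  fixes VG :: "int \<Rightarrow> 'v set"
  assumes subspace_VG: "V.subspace (VG n)"
    and direct_sum_VG: "internal_direct_sum VG"
    and act_VG: "x \<in> G m \<Longrightarrow> v \<in> VG n \<Longrightarrow> act x v \<in> VG (m + n)"

text \<open>
  The weight \<open>\<alpha>\<close> is a linear functional on the subspace \<open>G 0\<close>; its values elsewhere are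
  irrelevant.
\<close>

locale highest_weight_module = graded_lie_module scale bracket G scaleV act VG
  for scale :: "complex \<Rightarrow> 'g::ab_group_add \<Rightarrow> 'g"
    and bracket :: "'g \<Rightarrow> 'g \<Rightarrow> 'g"
    and G :: "int \<Rightarrow> 'g set"
    and scaleV :: "complex \<Rightarrow> 'v::ab_group_add \<Rightarrow> 'v"
    and act :: "'g \<Rightarrow> 'v \<Rightarrow> 'v"
    and VG :: "int \<Rightarrow> 'v set" +
  fixes \<alpha> :: "'g \<Rightarrow> complex"
    and w :: 'v
  assumes weight_add: "h \<in> G 0 \<Longrightarrow> k \<in> G 0 \<Longrightarrow> \<alpha> (h + k) = \<alpha> h + \<alpha> k"
    and weight_scale: "h \<in> G 0 \<Longrightarrow> \<alpha> (scale c h) = c * \<alpha> h"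
    and VG_neg: "n < 0 \<Longrightarrow> VG n = {0}"
    and VG_0: "VG 0 = V.span {w}"
    and w_nonzero: "w \<noteq> 0"
    and weight: "h \<in> G 0 \<Longrightarrow> act h w = scaleV (\<alpha> h) w"
    and neg_annihilates: "x \<in> neg_part \<Longrightarrow> act x w = 0"
    and generated: "{env_act u w | u. u \<in> carrier (env_algebra pos_part)} = UNIV"

section \<open>The Lie algebra \<open>\<L>\<^sub>L\<close> and its module \<open>\<S>\<close>\<close>

type_synonym LL = "nat \<times> nat \<Rightarrow>\<^sub>0 complex"
type_synonym SS = "nat \<Rightarrow>\<^sub>0 complex"

definition Z :: "nat \<Rightarrow> nat \<Rightarrow> LL" where
  "Z n m = Poly_Mapping.single (n, m) 1"

definition tvec :: "nat \<Rightarrow> SS" where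
  "tvec k = Poly_Mapping.single k 1"

definition Theta :: "int \<Rightarrow> complex" where
  "Theta x = (if x \<ge> 0 then 1 else 0)"

definition kdelta :: "nat \<Rightarrow> nat \<Rightarrow> complex" where
  "kdelta i j = (if i = j then 1 else 0)"

text \<open>
  The differences in the indices are truncated, but whenever truncation occurs the
  coefficient of the term vanishes.
\<close>

definition Z_bracket :: "nat \<Rightarrow> nat \<Rightarrow> nat \<Rightarrow> nat \<Rightarrow> LL" where
  "Z_bracket n m l s =
       pscale (Theta (int l - int m)) (Z (l - m + n) s)
     - pscale (Theta (int s - int n)) (Z l (s - n + m))
     - pscale (Theta (int n - int s)) (Z (n - s + l) m)
     + pscale (Theta (int m - int l)) (Z n (m - l + s))
     - pscale (kdelta m l) (Z n s)
     + pscale (kdelta n s) (Z l m)"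

definition LL_bracket :: "LL \<Rightarrow> LL \<Rightarrow> LL" where
  "LL_bracket x y =
    (\<Sum>(n, m) \<in> Poly_Mapping.keys x. \<Sum>(l, s) \<in> Poly_Mapping.keys y.
       pscale (Poly_Mapping.lookup x (n, m) * Poly_Mapping.lookup y (l, s)) (Z_bracket n m l s))"

definition LL_grade :: "int \<Rightarrow> LL set" where
  "LL_grade n = module.span pscale {Z k m | k m. int k - int m = n}"

definition Z_act :: "nat \<Rightarrow> nat \<Rightarrow> nat \<Rightarrow> SS" where
  "Z_act n m k = (if m > k then 0 else tvec (k - m + n))"

definition LL_act :: "LL \<Rightarrow> SS \<Rightarrow> SS" where
  "LL_act x v =
    (\<Sum>(n, m) \<in> Poly_Mapping.keys x. \<Sum>k \<in> Poly_Mapping.keys v.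
       pscale (Poly_Mapping.lookup x (n, m) * Poly_Mapping.lookup v k) (Z_act n m k))"

definition SS_grade :: "int \<Rightarrow> SS set" where
  "SS_grade n = module.span pscale {tvec k | k. int k = n}"

end

theory Submission
  imports Defs
begin

text \<open>
  The operators of the \<open>Z n m\<close> on \<open>\<S>\<close> are linearly independent: if \<open>m\<close> is minimal
  among the second indices that occur in \<open>x\<close>, then the action of \<open>x\<close> on \<open>t\<^sub>m\<close> exhibits the
  coefficients of the \<open>Z n m\<close>. The bracket of \<open>\<L>\<^sub>L\<close> is the commutator of the corresponding
  operators, so alternation and the Jacobi identity are inherited from composition of operators.
  For irreducibility, \<open>Z 0 k\<close> maps a vector with leading term \<open>c t\<^sub>k\<close> to \<open>c t\<^sub>0\<close>, and
  \<open>Z j 0\<close> maps \<open>t\<^sub>0\<close> to \<open>t\<^sub>j\<close>.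
\<close>

section \<open>Linear extension from a basis\<close>

lemma lookup_pscale [simp]: "Poly_Mapping.lookup (pscale c p) k = c * Poly_Mapping.lookup p k"
  by (simp add: pscale_def map.rep_eq when_def)

text \<open>One notion of linear extension, \<open>lin_ext\<close>, serves the bracket, the action
  on \<open>SS\<close> and the action of the free algebra on an arbitrary module; hence the target
  space is left generic.\<close>

locale complex_vector_space = vector_space scale
  for scale :: "complex \<Rightarrow> 'b::ab_group_add \<Rightarrow> 'b"
begin

definition lin_ext :: "('k \<Rightarrow> 'b) \<Rightarrow> ('k \<Rightarrow>\<^sub>0 complex) \<Rightarrow> 'b" where
  "lin_ext f p = (\<Sum>k\<in>Poly_Mapping.keys p. scale (Poly_Mapping.lookup p k) (f k))"

text \<open>Cancellation can shrink supports. Enlarging the index set only adds zero terms, so sums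
  over different supports become comparable.\<close>

lemma lin_ext_superset:
  fixes p :: "'k \<Rightarrow>\<^sub>0 complex"
  assumes "finite K" "Poly_Mapping.keys p \<subseteq> K"
  shows "lin_ext f p = (\<Sum>k\<in>K. scale (Poly_Mapping.lookup p k) (f k))"
  unfolding lin_ext_def using assms
  by (intro sum.mono_neutral_left) (auto simp: in_keys_iff)

lemma lin_ext_add: "lin_ext f (p + q) = lin_ext f p + lin_ext f q"
proof -
  let ?K = "Poly_Mapping.keys p \<union> Poly_Mapping.keys q"
  show ?thesis
    using keys_add[of p q]
    by (simp add: lin_ext_superset[of ?K] lookup_add scale_left_distrib sum.distrib)
qed

lemma lin_ext_single [simp]: "lin_ext f (Poly_Mapping.single k c) = scale c (f k)"
  by (simp add: lin_ext_def)

lemma lin_ext_0 [simp]: "lin_ext f 0 = 0"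
  by (simp add: lin_ext_def)

text \<open>Linearity in the family makes a nested extension linear in its inner argument; bilinear
  maps are treated as such nested extensions.\<close>

lemma lin_ext_fun_add: "lin_ext (\<lambda>k. f k + g k) p = lin_ext f p + lin_ext g p"
  by (simp add: lin_ext_def scale_right_distrib sum.distrib)

lemma lin_ext_fun_0 [simp]: "lin_ext (\<lambda>k. 0) p = 0"
  by (simp add: lin_ext_def)

lemma lin_ext_fun_scale: "lin_ext (\<lambda>k. scale c (f k)) p = scale c (lin_ext f p)"
  by (simp add: lin_ext_def scale_sum_right mult.commute)

lemma lin_ext_in_subspace:
  assumes "subspace W" "\<And>k. k \<in> Poly_Mapping.keys p \<Longrightarrow> f k \<in> W"
  shows "lin_ext f p \<in> W"
  unfolding lin_ext_def using assms by (intro subspace_sum subspace_scale)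

lemma lin_ext_pscale: "lin_ext f (pscale c p) = scale c (lin_ext f p)"
proof -
  have "Poly_Mapping.keys (pscale c p) \<subseteq> Poly_Mapping.keys p"
    by (auto simp: in_keys_iff)
  then show ?thesis
    by (simp add: lin_ext_superset[of "Poly_Mapping.keys p"] scale_sum_right)
qed

end

interpretation PS: complex_vector_space "pscale :: complex \<Rightarrow> ('a \<Rightarrow>\<^sub>0 complex) \<Rightarrow> _"
  by unfold_locales (auto intro!: poly_mapping_eqI simp: lookup_add algebra_simps)

lemma pscale_single: "pscale c (Poly_Mapping.single k a) = Poly_Mapping.single k (c * a)"
  by (rule poly_mapping_eqI) (simp add: lookup_single when_def)

lemma poly_mapping_eq_sum_single:
  "p = (\<Sum>k\<in>Poly_Mapping.keys p. Poly_Mapping.single k (Poly_Mapping.lookup p k))"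
  by (rule poly_mapping_eqI)
    (auto simp: lookup_sum lookup_single when_def in_keys_iff)

text \<open>A finitely supported function is the finite sum of its single terms, so additive
  identities need checking only on multiples of basis elements.\<close>

lemma poly_mapping_add_induct [case_names zero single add]:
  fixes p :: "'a \<Rightarrow>\<^sub>0 'b::comm_monoid_add"
  assumes zero: "P 0"
    and single: "\<And>k c. P (Poly_Mapping.single k c)"
    and add: "\<And>p q. P p \<Longrightarrow> P q \<Longrightarrow> P (p + q)"
  shows "P p"
proof -
  have "P (\<Sum>k\<in>K. Poly_Mapping.single k (Poly_Mapping.lookup p k))" if "finite K" for K
    using that by (induction K) (auto intro: assms)
  then show ?thesis
    by (subst poly_mapping_eq_sum_single) simp
qed

lemma poly_mapping_in_subspace:
  assumes "PS.subspace W" and "\<And>k. k \<in> Poly_Mapping.keys p \<Longrightarrow> Poly_Mapping.single k 1 \<in> W"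
  shows "p \<in> W"
proof -
  have "Poly_Mapping.single k (Poly_Mapping.lookup p k) \<in> W" if "k \<in> Poly_Mapping.keys p" for k
    using PS.subspace_scale[OF assms(1) assms(2)[OF that], of "Poly_Mapping.lookup p k"]
    by (simp add: pscale_single)
  then show ?thesis
    by (subst poly_mapping_eq_sum_single) (rule PS.subspace_sum[OF assms(1)])
qed

section \<open>Gradings by a degree function on the basis\<close>

text \<open>Turns the spans that define the gradings into conditions on supports.\<close>

lemma span_singles:
  "PS.span {Poly_Mapping.single k 1 | k. k \<in> A} = {p. Poly_Mapping.keys p \<subseteq> A}" (is "?L = ?R")
proof
  have "PS.subspace ?R"
  proof (rule PS.subspaceI)
    fix p q assume "p \<in> ?R" "q \<in> ?R"
    then show "p + q \<in> ?R"
      using keys_add[of p q] by blast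
  qed (auto simp: in_keys_iff)
  then show "?L \<subseteq> ?R"
    by (intro PS.span_minimal) auto
  show "?R \<subseteq> ?L"
  proof
    fix p assume "p \<in> ?R"
    then show "p \<in> ?L"
      by (auto intro: PS.span_base poly_mapping_in_subspace[OF PS.subspace_span, of p])
  qed
qed

lemma internal_direct_sum_degree:
  fixes d :: "'a \<Rightarrow> int"
  shows "internal_direct_sum (\<lambda>n. {p :: 'a \<Rightarrow>\<^sub>0 complex. Poly_Mapping.keys p \<subseteq> {k. d k = n}})"
  unfolding internal_direct_sum_def
proof (intro allI ex1I conjI)
  fix x :: "'a \<Rightarrow>\<^sub>0 complex"
  \<comment> \<open>The candidate for the component of degree \<open>n\<close>: the projection that
    kills basis elements of any other degree.\<close>
  define f where "f n = PS.lin_ext (\<lambda>k. if d k = n then Poly_Mapping.single k 1 else 0) x" for n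
  have lookup_f: "Poly_Mapping.lookup (f n) k = (if d k = n then Poly_Mapping.lookup x k else 0)" for n k
    unfolding f_def
    by (induction x rule: poly_mapping_add_induct)
      (auto simp: PS.lin_ext_add lookup_add lookup_single when_def)
  show "f n \<in> {p. Poly_Mapping.keys p \<subseteq> {k. d k = n}}" for n
    by (auto simp: in_keys_iff lookup_f split: if_splits)
  have "{n. f n \<noteq> 0} \<subseteq> d ` Poly_Mapping.keys x"
  proof (rule subsetI, rule ccontr)
    fix n assume *: "n \<in> {n. f n \<noteq> 0}" "n \<notin> d ` Poly_Mapping.keys x"
    then have "f n = 0"
      by (intro poly_mapping_eqI) (auto simp: lookup_f in_keys_iff)
    with * show False by simp
  qed
  then show fin: "finite {n. f n \<noteq> 0}"
    by (rule finite_subset) simp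
  \<comment> \<open>At an index \<open>k\<close> only the summand \<open>n = d k\<close> can
    contribute. If that component is zero and so absent from the sum, the coefficient of
    \<open>x\<close> at \<open>k\<close> is zero as well.\<close>
  show "x = (\<Sum>n\<in>{n. f n \<noteq> 0}. f n)"
    using fin
    by (intro poly_mapping_eqI)
      (auto simp: lookup_sum lookup_f, metis lookup_f lookup_zero)
  fix g
  assume g: "(\<forall>n. g n \<in> {p. Poly_Mapping.keys p \<subseteq> {k. d k = n}}) \<and> finite {n. g n \<noteq> 0} \<and>
    x = (\<Sum>n\<in>{n. g n \<noteq> 0}. g n)"
  have "k \<notin> Poly_Mapping.keys (g n)" if "d k \<noteq> n" for n k
    using g that by blast
  then have lookup_g: "Poly_Mapping.lookup (g n) k = 0" if "d k \<noteq> n" for n k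
    using that by (simp add: in_keys_iff)
  show "g = f"
  proof (intro ext poly_mapping_eqI)
    fix n k
    \<comment> \<open>Uniqueness: among the components of \<open>g\<close> only that of degree
      \<open>d k\<close> can have \<open>k\<close> in its support, so \<open>x\<close> determines
      its coefficient there.\<close>
    have "Poly_Mapping.lookup x k = (\<Sum>n\<in>{n. g n \<noteq> 0}. Poly_Mapping.lookup (g n) k)"
      using g by (simp flip: lookup_sum)
    also have "\<dots> = (\<Sum>n\<in>{n. g n \<noteq> 0}. if n = d k then Poly_Mapping.lookup (g n) k else 0)"
      using lookup_g by (intro sum.cong) auto
    also have "\<dots> = Poly_Mapping.lookup (g (d k)) k"
      using g by (auto simp: sum.delta)
    finally show "Poly_Mapping.lookup (g n) k = Poly_Mapping.lookup (f n) k"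
      using lookup_g by (auto simp: lookup_f)
  qed
qed

section \<open>The action of the enveloping algebra\<close>

lemma add_in_free_ring:
  "f \<in> carrier (free_ring P) \<Longrightarrow> g \<in> carrier (free_ring P) \<Longrightarrow> f + g \<in> carrier (free_ring P)"
  using keys_add[of f g] unfolding free_ring_def by auto

text \<open>The algebraic laws come from the ambient ring of finitely supported functions. What
  remains is closure, and words over \<open>P\<close> are closed under concatenation.\<close>

lemma free_ring_is_ring: "ring (free_ring P)"
proof (rule ringI)
  show "abelian_group (free_ring P)"
  proof (rule abelian_groupI)
    fix x assume "x \<in> carrier (free_ring P)"
    then have "- x \<in> carrier (free_ring P)" by (simp add: free_ring_def)
    then show "\<exists>y\<in>carrier (free_ring P). y \<oplus>\<^bsub>free_ring P\<^esub> x = \<zero>\<^bsub>free_ring P\<^esub>"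
      by (intro bexI[of _ "- x"]) (simp_all add: free_ring_def)
  next
    fix x y assume "x \<in> carrier (free_ring P)" "y \<in> carrier (free_ring P)"
    then show "x \<oplus>\<^bsub>free_ring P\<^esub> y \<in> carrier (free_ring P)"
      using add_in_free_ring[of x P y] by (simp add: free_ring_def)
  qed (auto simp: free_ring_def add.assoc add.commute)
  show "Group.monoid (free_ring P)"
  proof
    fix x y assume "x \<in> carrier (free_ring P)" "y \<in> carrier (free_ring P)"
    then show "x \<otimes>\<^bsub>free_ring P\<^esub> y \<in> carrier (free_ring P)"
      using keys_mult[of x y] by (fastforce simp: free_ring_def plus_word_def)
  qed (auto simp: free_ring_def mult.assoc zero_word_def)
qed (auto simp: free_ring_def algebra_simps)

lemma gen_in_free_ring: "x \<in> P \<Longrightarrow> gen x \<in> carrier (free_ring P)"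
  by (simp add: free_ring_def gen_def)

lemma pscale_in_free_ring: "f \<in> carrier (free_ring P) \<Longrightarrow> pscale c f \<in> carrier (free_ring P)"
  by (auto simp: free_ring_def in_keys_iff)

lemma diff_in_free_ring:
  "f \<in> carrier (free_ring P) \<Longrightarrow> g \<in> carrier (free_ring P) \<Longrightarrow> f - g \<in> carrier (free_ring P)"
  using keys_diff[of f g] by (fastforce simp: free_ring_def)

lemma mult_in_free_ring:
  "f \<in> carrier (free_ring P) \<Longrightarrow> g \<in> carrier (free_ring P) \<Longrightarrow> f * g \<in> carrier (free_ring P)"
  using monoid.m_closed[OF ring.is_monoid[OF free_ring_is_ring], of f P g]
  by (simp add: free_ring_def)

section \<open>The free algebra acting on a module\<close>

sublocale lie_module \<subseteq> CV: complex_vector_space scaleV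
  by unfold_locales

context lie_module
begin

lemma act_add_right: "act x (v + w) = act x v + act x w"
  and act_scale_right: "act x (scaleV c v) = scaleV c (act x v)"
  using act_linear_right[of x] by (simp_all add: Vector_Spaces.linear_iff)

lemma act_add_left: "act (x + y) v = act x v + act y v"
  and act_scale_left: "act (scale c x) v = scaleV c (act x v)"
  using act_linear_left[of v] by (simp_all add: Vector_Spaces.linear_iff)

lemma foldr_act_add: "foldr act u (v + w) = foldr act u v + foldr act u w"
  by (induction u) (simp_all add: act_add_right)

lemma foldr_act_scale: "foldr act u (scaleV c v) = scaleV c (foldr act u v)"
  by (induction u) (simp_all add: act_scale_right)

lemma foldr_act_0 [simp]: "foldr act u 0 = 0"
  using foldr_act_scale[of u 0 0] by simp

lemma free_act_eq_lin_ext: "free_act f v = CV.lin_ext (\<lambda>u. foldr act (letters u) v) f"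
  by (simp add: free_act_def CV.lin_ext_def)

lemma free_act_single [simp]:
  "free_act (Poly_Mapping.single u c) v = scaleV c (foldr act (letters u) v)"
  by (simp add: free_act_eq_lin_ext)

lemma free_act_0_left [simp]: "free_act 0 v = 0"
  by (simp add: free_act_eq_lin_ext)

lemma free_act_0_right [simp]: "free_act f 0 = 0"
  by (simp add: free_act_eq_lin_ext)

lemma free_act_add: "free_act (f + g) v = free_act f v + free_act g v"
  by (simp add: free_act_eq_lin_ext CV.lin_ext_add)

lemma free_act_diff: "free_act (f - g) v = free_act f v - free_act g v"
  using free_act_add[of "f - g" g v] by simp

lemma free_act_pscale: "free_act (pscale c f) v = scaleV c (free_act f v)"
  by (simp add: free_act_eq_lin_ext CV.lin_ext_pscale)

lemma free_act_gen [simp]: "free_act (gen x) v = act x v"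
  by (simp add: gen_def)

text \<open>Both sides are additive in \<open>f\<close> and in \<open>g\<close>, and on words
  \<open>foldr\<close> turns concatenation into composition.\<close>

lemma free_act_mult: "free_act (f * g) v = free_act f (free_act g v)"
proof (induction f rule: poly_mapping_add_induct)
  case (single k c)
  show ?case
    by (induction g rule: poly_mapping_add_induct)
      (simp_all add: mult_single plus_word_def foldr_act_scale foldr_act_add free_act_add
        distrib_left V.scale_right_distrib)
qed (simp_all add: free_act_add distrib_right)

text \<open>The action descends to the quotient: the annihilator of the module is a two-sided ideal,
  and it contains the relations because \<open>act\<close> is linear and turns brackets into
  commutators. Closure of \<open>P\<close> places the relations in the carrier.\<close>

lemma free_act_ideal:
  assumes P: "\<And>x y. x \<in> P \<Longrightarrow> y \<in> P \<Longrightarrow> x + y \<in> P" "\<And>c x. x \<in> P \<Longrightarrow> scale c x \<in> P"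
      "\<And>x y. x \<in> P \<Longrightarrow> y \<in> P \<Longrightarrow> bracket x y \<in> P"
    and i: "i \<in> Idl\<^bsub>free_ring P\<^esub> (env_relations P)"
  shows "free_act i v = 0"
proof -
  interpret R: ring "free_ring P" by (rule free_ring_is_ring)
  \<comment> \<open>Annihilating all vectors at once gives closure under multiplication on the
    right, since \<open>f * g\<close> applies \<open>f\<close> to
    \<open>free_act g v\<close>.\<close>
  let ?K = "{f \<in> carrier (free_ring P). \<forall>v. free_act f v = 0}"
  have neg: "\<ominus>\<^bsub>free_ring P\<^esub> f = - f" if "f \<in> carrier (free_ring P)" for f
    using that by (intro R.minus_equality) (auto simp: free_ring_def)
  have "ideal ?K (free_ring P)"
  proof (rule idealI[OF free_ring_is_ring])
    show "subgroup ?K (add_monoid (free_ring P))"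
    proof (rule R.add.subgroupI)
      show "?K \<noteq> {}" by (auto intro!: exI[of _ 0] simp: free_ring_def)
      fix f assume "f \<in> ?K"
      then show "\<ominus>\<^bsub>free_ring P\<^esub> f \<in> ?K"
        using R.a_inv_closed[of f] neg[of f] free_act_diff[of 0 f] by auto
      fix g assume "g \<in> ?K"
      with \<open>f \<in> ?K\<close> show "f \<oplus>\<^bsub>free_ring P\<^esub> g \<in> ?K"
        using R.a_closed[of f g] by (auto simp: free_act_add free_ring_def)
    qed auto
  next
    fix f g assume "f \<in> ?K" "g \<in> carrier (free_ring P)"
    then show "g \<otimes>\<^bsub>free_ring P\<^esub> f \<in> ?K" "f \<otimes>\<^bsub>free_ring P\<^esub> g \<in> ?K"
      using R.m_closed[of f g] R.m_closed[of g f] by (auto simp: free_act_mult free_ring_def)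
  qed
  moreover have "env_relations P \<subseteq> ?K"
    unfolding env_relations_def
    by (auto simp: free_act_diff free_act_mult free_act_pscale act_add_left act_scale_left
        act_bracket P
        intro!: diff_in_free_ring gen_in_free_ring pscale_in_free_ring mult_in_free_ring)
  ultimately show ?thesis
    using R.genideal_minimal i by blast
qed

text \<open>Representatives of a coset differ by elements of the ideal, which act as zero, so the
  set passed to \<open>the_elem\<close> is a singleton.\<close>

lemma env_act_coset:
  assumes P: "\<And>x y. x \<in> P \<Longrightarrow> y \<in> P \<Longrightarrow> x + y \<in> P" "\<And>c x. x \<in> P \<Longrightarrow> scale c x \<in> P"
      "\<And>x y. x \<in> P \<Longrightarrow> y \<in> P \<Longrightarrow> bracket x y \<in> P"
    and f: "f \<in> carrier (free_ring P)"
  shows "env_act (Idl\<^bsub>free_ring P\<^esub> (env_relations P) +>\<^bsub>free_ring P\<^esub> f) v = free_act f v"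
proof -
  interpret R: ring "free_ring P" by (rule free_ring_is_ring)
  let ?I = "Idl\<^bsub>free_ring P\<^esub> (env_relations P)"
  have "\<zero>\<^bsub>free_ring P\<^esub> \<in> ?I"
    unfolding genideal_def using additive_subgroup.zero_closed ideal.axioms(1) by blast
  \<comment> \<open>The coset must be nonempty for its image to have an element.\<close>
  then have "?I \<noteq> {}" by blast
  moreover have "free_act (i \<oplus>\<^bsub>free_ring P\<^esub> f) v = free_act f v" if "i \<in> ?I" for i
    using free_act_ideal[OF P that] by (simp add: free_ring_def free_act_add)
  ultimately have "(\<lambda>f. free_act f v) ` (?I +>\<^bsub>free_ring P\<^esub> f) = {free_act f v}"
    unfolding a_r_coset_def' image_UN by auto
  then show ?thesis
    by (simp add: env_act_def)
qed

text \<open>Reduces generation by the enveloping algebra to the action of noncommutative polynomials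
  in elements of \<open>P\<close>, since the quotient consists of their cosets.\<close>

lemma env_act_orbit:
  assumes P: "\<And>x y. x \<in> P \<Longrightarrow> y \<in> P \<Longrightarrow> x + y \<in> P" "\<And>c x. x \<in> P \<Longrightarrow> scale c x \<in> P"
      "\<And>x y. x \<in> P \<Longrightarrow> y \<in> P \<Longrightarrow> bracket x y \<in> P"
  shows "{env_act u v | u. u \<in> carrier (env_algebra P)} =
    {free_act f v | f. f \<in> carrier (free_ring P)}"
  unfolding env_algebra_def FactRing_def A_RCOSETS_def' Setcompr_eq_image
  by (auto simp: image_UN env_act_coset[OF P])

end

text \<open>Positive degrees add up to positive degrees; linearity extends this from homogeneous
  elements to the span, first in the right argument and then in the left. This supplies the closure
  under brackets used for the enveloping algebra of \<open>pos_part\<close>.\<close>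

lemma (in graded_lie_algebra) bracket_pos_part:
  assumes "x \<in> pos_part" "y \<in> pos_part"
  shows "bracket x y \<in> pos_part"
proof -
  have lin: "module_hom scale scale (\<lambda>y. bracket x y)" "module_hom scale scale (\<lambda>x. bracket x y)" for x y
    using bracket_linear_right bracket_linear_left by (simp_all add: module_hom_iff_linear)
  have base: "bracket a b \<in> pos_part" if "a \<in> G m" "b \<in> G n" "0 < m" "0 < n" for a b m n
  proof -
    have "bracket a b \<in> (\<Union>n\<in>{0<..}. G n)"
      using bracket_G[OF that(1,2)] that(3,4) by (intro UN_I[of "m + n"]) auto
    then show ?thesis
      unfolding pos_part_def by (rule span_base)
  qed
  have sub: "subspace pos_part" by (simp add: pos_part_def)
  have "bracket a y \<in> pos_part" if a: "a \<in> G m" "0 < m" for a m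
  proof -
    have "(\<Union>n\<in>{0<..}. G n) \<subseteq> (\<lambda>y. bracket a y) -` pos_part"
      using base[OF a(1) _ a(2)] by auto
    then have "pos_part \<subseteq> (\<lambda>y. bracket a y) -` pos_part"
      by (subst pos_part_def)
        (rule span_minimal[OF _ module_hom.subspace_vimage[OF lin(1) sub]])
    with assms(2) show ?thesis by auto
  qed
  then have "(\<Union>n\<in>{0<..}. G n) \<subseteq> (\<lambda>x. bracket x y) -` pos_part"
    by auto
  then have "pos_part \<subseteq> (\<lambda>x. bracket x y) -` pos_part"
    by (subst pos_part_def)
      (rule span_minimal[OF _ module_hom.subspace_vimage[OF lin(2) sub]])
  with assms(1) show ?thesis by auto
qed

section \<open>The algebra \<open>\<L>\<^sub>L\<close> acting on \<open>\<S>\<close>\<close>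

lemma LL_act_eq_lin_ext: "LL_act x v = PS.lin_ext (\<lambda>(n, m). PS.lin_ext (Z_act n m) v) x"
  by (simp add: LL_act_def PS.lin_ext_def PS.scale_sum_right case_prod_unfold)

lemma LL_bracket_eq_lin_ext:
  "LL_bracket x y = PS.lin_ext (\<lambda>(n, m). PS.lin_ext (\<lambda>(l, s). Z_bracket n m l s) y) x"
  by (simp add: LL_bracket_def PS.lin_ext_def PS.scale_sum_right case_prod_unfold)

lemma LL_act_add_left: "LL_act (x + y) v = LL_act x v + LL_act y v"
  by (simp add: LL_act_eq_lin_ext PS.lin_ext_add)

lemma LL_act_scale_left: "LL_act (pscale c x) v = pscale c (LL_act x v)"
  by (simp add: LL_act_eq_lin_ext PS.lin_ext_pscale)

lemma LL_act_add_right: "LL_act x (v + w) = LL_act x v + LL_act x w"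
  by (simp add: LL_act_eq_lin_ext PS.lin_ext_add PS.lin_ext_fun_add case_prod_unfold)

lemma LL_act_scale_right: "LL_act x (pscale c v) = pscale c (LL_act x v)"
  by (simp add: LL_act_eq_lin_ext PS.lin_ext_pscale PS.lin_ext_fun_scale case_prod_unfold)

lemma LL_act_0_left [simp]: "LL_act 0 v = 0"
  by (simp add: LL_act_eq_lin_ext)

lemma LL_act_0_right [simp]: "LL_act x 0 = 0"
  by (simp add: LL_act_eq_lin_ext case_prod_unfold)

lemma LL_act_diff_left: "LL_act (x - y) v = LL_act x v - LL_act y v"
  using LL_act_add_left[of "x - y" y v] by simp

lemma LL_act_diff_right: "LL_act x (v - w) = LL_act x v - LL_act x w"
  using LL_act_add_right[of x "v - w" w] by simp

lemma LL_bracket_add_left: "LL_bracket (x + y) z = LL_bracket x z + LL_bracket y z"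
  by (simp add: LL_bracket_eq_lin_ext PS.lin_ext_add)

lemma LL_bracket_scale_left: "LL_bracket (pscale c x) z = pscale c (LL_bracket x z)"
  by (simp add: LL_bracket_eq_lin_ext PS.lin_ext_pscale)

lemma LL_bracket_add_right: "LL_bracket x (y + z) = LL_bracket x y + LL_bracket x z"
  by (simp add: LL_bracket_eq_lin_ext PS.lin_ext_add PS.lin_ext_fun_add case_prod_unfold)

lemma LL_bracket_scale_right: "LL_bracket x (pscale c z) = pscale c (LL_bracket x z)"
  by (simp add: LL_bracket_eq_lin_ext PS.lin_ext_pscale PS.lin_ext_fun_scale case_prod_unfold)

lemma LL_bracket_0_left [simp]: "LL_bracket 0 z = 0"
  by (simp add: LL_bracket_eq_lin_ext)

lemma LL_bracket_0_right [simp]: "LL_bracket x 0 = 0"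
  by (simp add: LL_bracket_eq_lin_ext case_prod_unfold)

lemma LL_act_Z [simp]: "LL_act (Z n m) (tvec k) = Z_act n m k"
  by (simp add: LL_act_eq_lin_ext Z_def tvec_def)

lemma LL_bracket_Z [simp]: "LL_bracket (Z n m) (Z l s) = Z_bracket n m l s"
  by (simp add: LL_bracket_eq_lin_ext Z_def)

section \<open>The bracket as a commutator of operators\<close>

lemma single_eq_pscale_Z: "Poly_Mapping.single (n, m) c = pscale c (Z n m)"
  by (simp add: Z_def pscale_single)

lemma single_eq_pscale_tvec: "Poly_Mapping.single k c = pscale c (tvec k)"
  by (simp add: tvec_def pscale_single)

text \<open>Product rule for two basis operators. Raising by \<open>l\<close> and then lowering by
  \<open>m\<close> combine to a net raising if \<open>l \<ge> m\<close> and to a net lowering if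
  \<open>m \<ge> l\<close>. Both cases apply when \<open>m = l\<close>, and the
  \<open>kdelta\<close> term removes the double count.\<close>

lemma LL_act_Z_Z_act:
  "LL_act (Z n m) (Z_act l s k) =
     pscale (Theta (int l - int m)) (Z_act (l - m + n) s k)
   + pscale (Theta (int m - int l)) (Z_act n (m - l + s) k)
   - pscale (kdelta m l) (Z_act n s k)"
  by (cases m l rule: linorder_cases; cases "s \<le> k")
    (auto simp: Z_act_def Theta_def kdelta_def intro!: arg_cong[of _ _ tvec])

lemma LL_act_bracket: "LL_act (LL_bracket x y) v = LL_act x (LL_act y v) - LL_act y (LL_act x v)"
proof (induction x rule: poly_mapping_add_induct)
  case (single q a)
  obtain n m where q: "q = (n, m)" by fastforce
  show ?case
  proof (induction y rule: poly_mapping_add_induct)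
    case (single r b)
    obtain l s where r: "r = (l, s)" by fastforce
    show ?case
    proof (induction v rule: poly_mapping_add_induct)
      case (single k c)
      \<comment> \<open>Subtracting the product rule with the two index pairs exchanged leaves
        exactly the six terms of \<open>Z_bracket\<close>; \<open>kdelta\<close> is unfolded for its
        symmetry.\<close>
      have "LL_act (Z_bracket n m l s) (tvec k) =
          LL_act (Z n m) (Z_act l s k) - LL_act (Z l s) (Z_act n m k)"
        by (simp add: Z_bracket_def LL_act_add_left LL_act_diff_left LL_act_scale_left
            LL_act_Z_Z_act kdelta_def algebra_simps)
      then show ?case
        by (simp add: q r single_eq_pscale_Z single_eq_pscale_tvec LL_act_scale_left
            LL_act_scale_right LL_bracket_scale_left LL_bracket_scale_right
            PS.scale_right_diff_distrib mult_ac)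
    qed (simp_all add: LL_act_add_right)
  qed (simp_all add: LL_act_add_left LL_act_add_right LL_bracket_add_right)
qed (simp_all add: LL_act_add_left LL_act_add_right LL_bracket_add_left)

text \<open>Transfers identities between operators back to the algebra; alternation and the Jacobi
  identity are obtained in this way.\<close>

lemma LL_act_faithful:
  assumes "\<And>v. LL_act x v = 0"
  shows "x = 0"
proof (rule ccontr)
  assume "x \<noteq> 0"
  then have "snd ` Poly_Mapping.keys x \<noteq> {}" by simp
  define m where "m = Min (snd ` Poly_Mapping.keys x)"
  have "m \<in> snd ` Poly_Mapping.keys x"
    unfolding m_def using \<open>x \<noteq> 0\<close> by (intro Min_in) auto
  then obtain n where nm: "(n, m) \<in> Poly_Mapping.keys x" by auto
  have min: "m \<le> snd q" if "q \<in> Poly_Mapping.keys x" for q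
    unfolding m_def using that by (intro Min_le) auto
  have "Poly_Mapping.lookup (LL_act x (tvec m)) n =
      (\<Sum>q\<in>Poly_Mapping.keys x. Poly_Mapping.lookup x q * Poly_Mapping.lookup (Z_act (fst q) (snd q) m) n)"
    by (simp add: LL_act_eq_lin_ext tvec_def case_prod_unfold PS.lin_ext_def[of _ x] lookup_sum)
  \<comment> \<open>Terms with second index above \<open>m\<close> kill \<open>tvec m\<close>. By
    minimality the others have second index \<open>m\<close> and send \<open>tvec m\<close> to the
    basis vector of their first index.\<close>
  also have "\<dots> = (\<Sum>q\<in>Poly_Mapping.keys x. if q = (n, m) then Poly_Mapping.lookup x q else 0)"
    by (intro sum.cong) (auto dest!: min simp: Z_act_def tvec_def lookup_single when_def)
  also have "\<dots> = Poly_Mapping.lookup x (n, m)"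
    using nm by simp
  finally show False
    using nm assms by (simp add: in_keys_iff)
qed

interpretation LL: lie_algebra pscale LL_bracket
proof (intro lie_algebra.intro lie_algebra_axioms.intro PS.vector_space_axioms)
  show "Vector_Spaces.linear pscale pscale (LL_bracket x)" for x
    by (simp add: Vector_Spaces.linear_iff PS.vector_space_axioms LL_bracket_add_right
        LL_bracket_scale_right)
  show "Vector_Spaces.linear pscale pscale (\<lambda>x. LL_bracket x y)" for y
    by (simp add: Vector_Spaces.linear_iff PS.vector_space_axioms LL_bracket_add_left
        LL_bracket_scale_left)
  show "LL_bracket x x = 0" for x
    by (rule LL_act_faithful) (simp add: LL_act_bracket)
  \<comment> \<open>As operators, the three double commutators expand into twelve compositions that
    cancel in pairs.\<close>
  show "LL_bracket x (LL_bracket y z) + LL_bracket y (LL_bracket z x)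
      + LL_bracket z (LL_bracket x y) = 0" for x y z
    by (rule LL_act_faithful) (simp add: LL_act_bracket LL_act_add_left LL_act_diff_right)
qed

section \<open>The gradings of the algebra and the module\<close>

lemma LL_grade_eq: "LL_grade n = {x. Poly_Mapping.keys x \<subseteq> {(k, m). int k - int m = n}}"
proof -
  have "{Z k m | k m. int k - int m = n} =
      {Poly_Mapping.single q 1 | q. q \<in> {(k, m). int k - int m = n}}"
    by (auto simp: Z_def)
  then show ?thesis
    by (simp only: LL_grade_def span_singles)
qed

lemma SS_grade_eq: "SS_grade n = {v. Poly_Mapping.keys v \<subseteq> {k. int k = n}}"
  using span_singles[of "{k. int k = n}"] by (simp add: SS_grade_def tvec_def)

lemma subspace_LL_grade: "PS.subspace (LL_grade n)"
  by (simp add: LL_grade_def)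

lemma subspace_SS_grade: "PS.subspace (SS_grade n)"
  by (simp add: SS_grade_def)

text \<open>The degree condition is restricted to nonzero coefficients because a truncated
  difference in \<open>Z_bracket\<close> can give a wrong degree, but only where the coefficient
  vanishes.\<close>

lemma pscale_Z_in_LL_grade:
  "(c \<noteq> 0 \<Longrightarrow> int k - int m = d) \<Longrightarrow> pscale c (Z k m) \<in> LL_grade d"
  by (auto simp: LL_grade_eq Z_def pscale_single)

lemma Z_bracket_in_LL_grade:
  "Z_bracket n m l s \<in> LL_grade ((int n - int m) + (int l - int s))"
  unfolding Z_bracket_def
  by (intro PS.subspace_add PS.subspace_diff subspace_LL_grade pscale_Z_in_LL_grade)
    (auto simp: Theta_def kdelta_def split: if_splits)

lemma LL_bracket_in_LL_grade:
  assumes "x \<in> LL_grade m" "y \<in> LL_grade n"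
  shows "LL_bracket x y \<in> LL_grade (m + n)"
proof -
  have "int i - int j = m" if "(i, j) \<in> Poly_Mapping.keys x" for i j
    using that assms(1) by (auto simp: LL_grade_eq)
  moreover have "int i - int j = n" if "(i, j) \<in> Poly_Mapping.keys y" for i j
    using that assms(2) by (auto simp: LL_grade_eq)
  ultimately show ?thesis
    unfolding LL_bracket_eq_lin_ext
    using Z_bracket_in_LL_grade
    by (fastforce intro!: PS.lin_ext_in_subspace subspace_LL_grade)
qed

lemma LL_act_in_SS_grade:
  assumes "x \<in> LL_grade m" "v \<in> SS_grade n"
  shows "LL_act x v \<in> SS_grade (m + n)"
proof -
  have "int i - int j = m" if "(i, j) \<in> Poly_Mapping.keys x" for i j
    using that assms(1) by (auto simp: LL_grade_eq)
  moreover have "int k = n" if "k \<in> Poly_Mapping.keys v" for k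
    using that assms(2) by (auto simp: SS_grade_eq)
  \<comment> \<open>If \<open>j \<le> k\<close>, the subtraction in \<open>Z_act\<close> is exact;
    otherwise the value is zero, which lies in every degree.\<close>
  moreover have "Z_act i j k \<in> SS_grade (int i - int j + int k)" for i j k
    by (auto simp: SS_grade_eq Z_act_def tvec_def)
  ultimately show ?thesis
    unfolding LL_act_eq_lin_ext
    by (fastforce intro!: PS.lin_ext_in_subspace subspace_SS_grade)
qed

interpretation LL: graded_lie_algebra pscale LL_bracket LL_grade
proof
  show "internal_direct_sum LL_grade"
    using internal_direct_sum_degree[of "\<lambda>(k, m). int k - int m"]
    by (simp add: LL_grade_eq[abs_def] case_prod_unfold)
qed (fact subspace_LL_grade LL_bracket_in_LL_grade)+

interpretation SS: graded_lie_module pscale LL_bracket LL_grade pscale LL_act SS_grade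
proof (intro graded_lie_module.intro lie_module.intro lie_module_axioms.intro
    graded_lie_module_axioms.intro LL.graded_lie_algebra_axioms LL.lie_algebra_axioms
    PS.vector_space_axioms)
  show "Vector_Spaces.linear pscale pscale (LL_act x)" for x
    by (simp add: Vector_Spaces.linear_iff PS.vector_space_axioms LL_act_add_right
        LL_act_scale_right)
  show "Vector_Spaces.linear pscale pscale (\<lambda>x. LL_act x v)" for v
    by (simp add: Vector_Spaces.linear_iff PS.vector_space_axioms LL_act_add_left
        LL_act_scale_left)
  show "internal_direct_sum SS_grade"
    using internal_direct_sum_degree[of int] by (simp add: SS_grade_eq[abs_def])
qed (fact LL_act_bracket subspace_SS_grade LL_act_in_SS_grade)+

section \<open>Generation by the highest weight vector and irreducibility\<close>

text \<open>Since \<open>Z k 0\<close> sends \<open>tvec 0\<close> to \<open>tvec k\<close>, a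
  single positive element produces all of \<open>v\<close> except its multiple of
  \<open>tvec 0\<close>. The index 0 is left out of \<open>x\<close> because \<open>Z 0 0\<close>
  has degree 0.\<close>

lemma SS_decompose:
  fixes v :: SS
  defines "x \<equiv> PS.lin_ext (\<lambda>k. if k = 0 then 0 else Z k 0) v"
  shows "x \<in> LL.pos_part" and "v = pscale (Poly_Mapping.lookup v 0) (tvec 0) + LL_act x (tvec 0)"
proof -
  have sub: "PS.subspace LL.pos_part"
    unfolding LL.pos_part_def by (rule PS.subspace_span)
  have Z: "Z k 0 \<in> LL.pos_part" if "k \<noteq> 0" for k
  proof -
    have "Z k 0 \<in> LL_grade (int k)"
      using pscale_Z_in_LL_grade[of 1 k 0] by simp
    with that have "Z k 0 \<in> (\<Union>n\<in>{0<..}. LL_grade n)"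
      by (intro UN_I[of "int k"]) simp_all
    then show ?thesis
      unfolding LL.pos_part_def by (rule PS.span_base)
  qed
  have "(if k = 0 then 0 else Z k 0) \<in> LL.pos_part" for k
    using Z PS.subspace_0[OF sub] by simp
  then show "x \<in> LL.pos_part"
    unfolding x_def by (rule PS.lin_ext_in_subspace[OF sub])
  show "v = pscale (Poly_Mapping.lookup v 0) (tvec 0) + LL_act x (tvec 0)"
    unfolding x_def
  proof (induction v rule: poly_mapping_add_induct)
    case (single k c)
    then show ?case
      by (cases "k = 0")
        (simp_all add: LL_act_scale_left Z_act_def lookup_single flip: single_eq_pscale_tvec)
  next
    case (add p q)
    show ?case
      by (rule trans[OF arg_cong2[OF add.IH, of "(+)"]])
        (simp only: PS.lin_ext_add LL_act_add_left lookup_add PS.scale_left_distrib ac_simps)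
  qed simp
qed

lemma SS_submodule_irreducible:
  assumes W: "SS.submodule W" and "W \<noteq> {0}"
  shows "W = UNIV"
proof -
  have sub: "PS.subspace W" and act: "\<And>x v. v \<in> W \<Longrightarrow> LL_act x v \<in> W"
    using W by (auto simp: SS.submodule_def)
  obtain v where v: "v \<in> W" "v \<noteq> 0"
    using \<open>W \<noteq> {0}\<close> PS.subspace_0[OF sub] by blast
  define k where "k = Max (Poly_Mapping.keys v)"
  have k: "k \<in> Poly_Mapping.keys v"
    unfolding k_def using v by (intro Max_in) auto
  have max: "j \<le> k" if "j \<in> Poly_Mapping.keys v" for j
    unfolding k_def using that by (intro Max_ge) auto
  have "LL_act (Z 0 k) v = PS.lin_ext (Z_act 0 k) v"
    by (simp add: LL_act_eq_lin_ext Z_def)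
  also have "\<dots> = (\<Sum>j\<in>Poly_Mapping.keys v. if j = k then pscale (Poly_Mapping.lookup v k) (tvec 0) else 0)"
    unfolding PS.lin_ext_def by (intro sum.cong) (auto dest!: max simp: Z_act_def)
  also have "\<dots> = pscale (Poly_Mapping.lookup v k) (tvec 0)"
    using k by simp
  finally have "pscale (Poly_Mapping.lookup v k) (tvec 0) \<in> W"
    using act[OF v(1), of "Z 0 k"] by simp
  \<comment> \<open>The leading coefficient is nonzero because \<open>k\<close> is a key, so it can
    be divided out.\<close>
  from PS.subspace_scale[OF sub this, of "1 / Poly_Mapping.lookup v k"]
  have t0: "tvec 0 \<in> W"
    using k by (simp add: in_keys_iff)
  \<comment> \<open>Every vector arises from \<open>tvec 0\<close> by scaling, one action and a sum,
    and \<open>W\<close> is closed under all three.\<close>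
  have "v \<in> W" for v
    by (subst SS_decompose(2)) (intro PS.subspace_add[OF sub] PS.subspace_scale[OF sub] act t0)
  then show ?thesis by auto
qed

theorem proposition2p11:
  shows "(\<exists>\<alpha> :: LL \<Rightarrow> complex.
            highest_weight_module pscale LL_bracket LL_grade pscale LL_act SS_grade \<alpha> (tvec 0))
       \<and> irreducible_lie_module pscale LL_bracket pscale LL_act"
proof
  have nonzero: "tvec 0 \<noteq> 0"
    by (simp add: tvec_def flip: keys_eq_empty)
  have SS_0: "SS_grade 0 = PS.span {tvec 0}"
  proof -
    have "{tvec k | k. int k = 0} = {tvec 0}" by auto
    then show ?thesis by (simp only: SS_grade_def)
  qed
  \<comment> \<open>For \<open>h\<close> of degree 0 the vector \<open>LL_act h (tvec 0)\<close>
    lies in the line spanned by \<open>tvec 0\<close>, so this coefficient is the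
    eigenvalue.\<close>
  define \<alpha> where "\<alpha> h = Poly_Mapping.lookup (LL_act h (tvec 0)) 0" for h
  have "highest_weight_module pscale LL_bracket LL_grade pscale LL_act SS_grade \<alpha> (tvec 0)"
  proof
    show "SS_grade n = {0}" if "n < 0" for n
      using that by (auto simp: SS_grade_eq)
    show "LL_act h (tvec 0) = pscale (\<alpha> h) (tvec 0)" if "h \<in> LL_grade 0" for h
    proof -
      have "LL_act h (tvec 0) \<in> SS_grade 0"
        using LL_act_in_SS_grade[OF that, of "tvec 0" 0] by (simp add: SS_0 PS.span_base)
      then obtain c where "LL_act h (tvec 0) = pscale c (tvec 0)"
        by (auto simp: SS_0 PS.span_singleton)
      then show ?thesis
        by (simp add: \<alpha>_def tvec_def)
    qed
    show "LL_act x (tvec 0) = 0" if "x \<in> LL.neg_part" for x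
    proof -
      \<comment> \<open>The annihilator of \<open>tvec 0\<close> is a subspace, so homogeneous
        elements suffice. They send \<open>tvec 0\<close> into a negative degree, where the module
        is zero.\<close>
      let ?K = "{x. LL_act x (tvec 0) = 0}"
      have "PS.subspace ?K"
        by (rule PS.subspaceI) (simp_all add: LL_act_add_left LL_act_scale_left)
      moreover have "(\<Union>n\<in>{..<0}. LL_grade n) \<subseteq> ?K"
      proof
        fix x assume "x \<in> (\<Union>n\<in>{..<0}. LL_grade n)"
        then obtain n where "n < 0" "x \<in> LL_grade n" by auto
        moreover have "tvec 0 \<in> SS_grade 0" by (simp add: SS_0 PS.span_base)
        ultimately have "LL_act x (tvec 0) \<in> SS_grade n" "n < 0"
          using LL_act_in_SS_grade by fastforce+
        then show "x \<in> ?K" by (auto simp: SS_grade_eq)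
      qed
      ultimately have "LL.neg_part \<subseteq> ?K"
        unfolding LL.neg_part_def by (intro PS.span_minimal)
      with that show ?thesis by auto
    qed
    have "v \<in> {SS.free_act f (tvec 0) | f. f \<in> carrier (free_ring LL.pos_part)}" for v
    proof -
      define x where "x = PS.lin_ext (\<lambda>k. if k = 0 then 0 else Z k 0) v"
      \<comment> \<open>The empty word acts as the identity and supplies the multiple of
        \<open>tvec 0\<close>; the word with the single letter \<open>x\<close> supplies the
        rest.\<close>
      define f where "f = Poly_Mapping.single (Word []) (Poly_Mapping.lookup v 0) + gen x"
      have "gen x \<in> carrier (free_ring LL.pos_part)"
        using SS_decompose(1)[of v] by (intro gen_in_free_ring) (simp add: x_def)
      then have "f \<in> carrier (free_ring LL.pos_part)"
        unfolding f_def by (intro add_in_free_ring) (simp_all add: free_ring_def)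
      moreover have "v = SS.free_act f (tvec 0)"
        using SS_decompose(2)[of v] by (simp add: f_def x_def SS.free_act_add)
      ultimately show ?thesis by blast
    qed
    moreover have "x + y \<in> LL.pos_part" "pscale c x \<in> LL.pos_part"
      if "x \<in> LL.pos_part" "y \<in> LL.pos_part" for x y c
      using that by (simp_all add: LL.pos_part_def PS.span_add PS.span_scale)
    ultimately show "{SS.env_act u (tvec 0) | u. u \<in> carrier (LL.env_algebra LL.pos_part)} = UNIV"
      using LL.bracket_pos_part by (subst SS.env_act_orbit) auto
  qed (fact SS_0 nonzero | simp add: \<alpha>_def LL_act_add_left LL_act_scale_left lookup_add)+
  then show "\<exists>\<alpha> :: LL \<Rightarrow> complex.
      highest_weight_module pscale LL_bracket LL_grade pscale LL_act SS_grade \<alpha> (tvec 0)"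
    by (intro exI)
  show "irreducible_lie_module pscale LL_bracket pscale LL_act"
    using nonzero SS_submodule_irreducible by unfold_locales blast+
qed

end
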